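(* Let $n>1$ be an integer and let $B(1,n)=\langle a,b : a^{-1}ba=b^n\rangle$ be the Baumslag–Solitar group. For any injective homomorphism $\phi:B(1,n)\to B(1,n)$ the Reidemeister number $R(\phi)$ is infinite.
   Context: For an endomorphism $\phi$ of a group $G$, two elements $x,x'\in G$ are $\phi$-conjugate if $x'=gx\phi(g^{-1})$ for some $g\in G$; the Reidemeister number $R(\phi)$ is the number of $\phi$-conjugacy classes. *)

theory Defs
  imports "HOL-Algebra.Group" "HOL-Library.Extended_Nat"
begin

text \<open>Group presentations. Words are lists of signed letters, \<open>Neg x\<close> standing for the inverse
  of the generator \<open>x\<close>; all elements of the type \<open>'g\<close> are generators. The presented group is the
  set of words modulo the smallest congruence containing free cancellation and the given
  relations; a relation \<open>u = v\<close> is the pair \<open>(u, v)\<close>.\<close>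

datatype 'g letter = Pos 'g | Neg 'g

fun inv_letter :: "'g letter \<Rightarrow> 'g letter" where
  "inv_letter (Pos x) = Neg x"
| "inv_letter (Neg x) = Pos x"

type_synonym 'g gword = "'g letter list"

inductive_set pres_rel :: "('g gword \<times> 'g gword) set \<Rightarrow> ('g gword \<times> 'g gword) set"
  for R :: "('g gword \<times> 'g gword) set" where
  refl: "(u, u) \<in> pres_rel R"
| sym: "(u, v) \<in> pres_rel R \<Longrightarrow> (v, u) \<in> pres_rel R"
| trans: "(u, v) \<in> pres_rel R \<Longrightarrow> (v, w) \<in> pres_rel R \<Longrightarrow> (u, w) \<in> pres_rel R"
| mult: "(u, u') \<in> pres_rel R \<Longrightarrow> (v, v') \<in> pres_rel R \<Longrightarrow> (u @ v, u' @ v') \<in> pres_rel R"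
| cancel: "([l, inv_letter l], []) \<in> pres_rel R"
| rel: "(u, v) \<in> R \<Longrightarrow> (u, v) \<in> pres_rel R"

definition presented_group :: "('g gword \<times> 'g gword) set \<Rightarrow> 'g gword set monoid" where
  "presented_group R =
    \<lparr>carrier = UNIV // pres_rel R,
     mult = (\<lambda>X Y. \<Union>u\<in>X. \<Union>v\<in>Y. pres_rel R `` {u @ v}),
     one = pres_rel R `` {[]}\<rparr>"

lemma equiv_pres_rel: "equiv UNIV (pres_rel R)"
  by (rule equivI)
    (auto simp: refl_on_def intro: symI transI pres_rel.refl pres_rel.sym pres_rel.trans)

lemma presented_group_mult:
  "pres_rel R `` {u} \<otimes>\<^bsub>presented_group R\<^esub> pres_rel R `` {v} = pres_rel R `` {u @ v}"
proof -
  have "congruent2 (pres_rel R) (pres_rel R) (\<lambda>u v. pres_rel R `` {u @ v})"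
    by (rule congruent2I'[where ?r1.0 = "pres_rel R" and ?r2.0 = "pres_rel R"])
      (metis equiv_class_eq[OF equiv_pres_rel] pres_rel.mult)
  then show ?thesis
    unfolding presented_group_def
    using UN_equiv_class2[OF equiv_pres_rel equiv_pres_rel, of R R] by simp
qed

lemma pres_rel_inverse: "(rev (map inv_letter w) @ w, []) \<in> pres_rel R"
proof (induction w)
  case Nil
  show ?case by (simp add: pres_rel.refl)
next
  case (Cons l w)
  have "([inv_letter l, l], []) \<in> pres_rel R"
    using pres_rel.cancel[of "inv_letter l" R] by (cases l) auto
  from pres_rel.mult[OF pres_rel.refl pres_rel.mult[OF this pres_rel.refl]]
  have "(rev (map inv_letter w) @ [inv_letter l, l] @ w, rev (map inv_letter w) @ [] @ w)
      \<in> pres_rel R" .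
  then have "(rev (map inv_letter (l # w)) @ l # w, rev (map inv_letter w) @ w) \<in> pres_rel R"
    by simp
  then show ?case using Cons.IH by (rule pres_rel.trans)
qed

lemma group_presented_group: "group (presented_group R)"
proof -
  let ?G = "presented_group R" and ?c = "\<lambda>w. pres_rel R `` {w}"
  have carr: "carrier ?G = range ?c" and one: "\<one>\<^bsub>?G\<^esub> = ?c []"
    by (auto simp: presented_group_def quotient_def)
  show ?thesis
  proof (rule groupI)
    fix X assume "X \<in> carrier ?G"
    then obtain w where w: "X = ?c w" by (auto simp: carr)
    have "?c (rev (map inv_letter w)) \<otimes>\<^bsub>?G\<^esub> X = \<one>\<^bsub>?G\<^esub>"
      unfolding w one presented_group_mult
      by (rule equiv_class_eq[OF equiv_pres_rel pres_rel_inverse])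
    then show "\<exists>Y\<in>carrier ?G. Y \<otimes>\<^bsub>?G\<^esub> X = \<one>\<^bsub>?G\<^esub>" by (auto simp: carr)
  qed (auto simp: carr one presented_group_mult)
qed

datatype bs_gen = gen_a | gen_b

text \<open>\<open>B(1,n) = \<langle>a, b : a\<^sup>-\<^sup>1 b a = b\<^sup>n\<rangle>\<close>\<close>

definition BS1 :: "nat \<Rightarrow> bs_gen gword set monoid" where
  "BS1 n = presented_group {([Neg gen_a, Pos gen_b, Pos gen_a], replicate n (Pos gen_b))}"

definition twisted_conj :: "('a, 'm) monoid_scheme \<Rightarrow> ('a \<Rightarrow> 'a) \<Rightarrow> ('a \<times> 'a) set" where
  "twisted_conj G \<phi> = {(x, x'). x \<in> carrier G \<and> x' \<in> carrier G \<and>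
     (\<exists>g\<in>carrier G. x' = g \<otimes>\<^bsub>G\<^esub> x \<otimes>\<^bsub>G\<^esub> \<phi> (inv\<^bsub>G\<^esub> g))}"

definition reidemeister_number :: "('a, 'm) monoid_scheme \<Rightarrow> ('a \<Rightarrow> 'a) \<Rightarrow> enat" where
  "reidemeister_number G \<phi> =
    (let C = carrier G // twisted_conj G \<phi> in if finite C then enat (card C) else \<infinity>)"

text \<open>Twisted conjugacy is an equivalence relation for an endomorphism, so the quotient above
  consists of the \<open>\<phi>\<close>-conjugacy classes.\<close>

lemma (in group) equiv_twisted_conj:
  assumes "\<phi> \<in> hom G G"
  shows "equiv (carrier G) (twisted_conj G \<phi>)"
proof -
  interpret group_hom G G \<phi>
    using assms by unfold_locales
  show ?thesis
  proof (rule equivI)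
    show "twisted_conj G \<phi> \<subseteq> carrier G \<times> carrier G"
      by (auto simp: twisted_conj_def)
    show "refl_on (carrier G) (twisted_conj G \<phi>)"
      by (auto simp: twisted_conj_def refl_on_def intro!: bexI[of _ \<one>])
    show "sym (twisted_conj G \<phi>)"
    proof (rule symI)
      fix x y assume "(x, y) \<in> twisted_conj G \<phi>"
      then obtain g where g: "g \<in> carrier G" "x \<in> carrier G" "y = g \<otimes> x \<otimes> \<phi> (inv g)"
        by (auto simp: twisted_conj_def)
      have "inv g \<otimes> y \<otimes> \<phi> (inv (inv g)) = (inv g \<otimes> g) \<otimes> x \<otimes> (\<phi> (inv g) \<otimes> \<phi> g)"
        using g by (simp add: m_assoc del: l_inv hom_inv) (simp flip: m_assoc)
      also have "\<dots> = x" using g by (simp flip: hom_mult)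
      finally show "(y, x) \<in> twisted_conj G \<phi>"
        using g by (auto simp: twisted_conj_def intro!: bexI[of _ "inv g"])
    qed
    show "trans (twisted_conj G \<phi>)"
    proof (rule transI)
      fix x y z assume "(x, y) \<in> twisted_conj G \<phi>" "(y, z) \<in> twisted_conj G \<phi>"
      then obtain g h where g: "g \<in> carrier G" "x \<in> carrier G" "y = g \<otimes> x \<otimes> \<phi> (inv g)"
        and h: "h \<in> carrier G" "z = h \<otimes> y \<otimes> \<phi> (inv h)"
        by (auto simp: twisted_conj_def)
      have "z = (h \<otimes> g) \<otimes> x \<otimes> \<phi> (inv (h \<otimes> g))"
        using g h by (simp add: m_assoc inv_mult_group)
      then show "(x, z) \<in> twisted_conj G \<phi>"
        using g h by (auto simp: twisted_conj_def intro!: bexI[of _ "h \<otimes> g"])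
    qed
  qed
qed

end

theory Submission
  imports Defs Complex_Main "HOL-Algebra.Elementary_Groups"
begin

text \<open>
  The group \<open>B(1,n)\<close> is the semidirect product of \<open>\<int>[1/n]\<close>, generated by the conjugates of \<open>b\<close>, with
  the infinite cyclic group generated by \<open>a\<close>, which acts by multiplication by powers of \<open>n\<close>.
  Let \<open>p\<close> be the projection onto the cyclic factor, the exponent sum of \<open>a\<close>. The whole proof is that
  an injective endomorphism \<open>\<phi>\<close> satisfies \<open>p \<circ> \<phi> = p\<close>. Then \<open>p (g x \<phi>(g)\<^sup>-\<^sup>1) = p x\<close>, so \<open>p\<close> is constant
  on \<open>\<phi>\<close>-conjugacy classes and takes infinitely many values
  (\<open>reidemeister_number_infinite_if_fixed_hom\<close>).

  To see that \<open>p \<circ> \<phi> = p\<close>, look at the relation \<open>ba = ab\<^sup>n\<close>. Applying \<open>p \<circ> \<phi>\<close> gives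
  \<open>p(\<phi> b) = n p(\<phi> b)\<close>, so \<open>\<phi> b\<close> lies in \<open>\<int>[1/n]\<close>, and there conjugation by \<open>\<phi> a\<close> is multiplication by
  \<open>n\<^sup>k\<close>, where \<open>k = p(\<phi> a)\<close>. The relation therefore says \<open>n\<^sup>k x = n x\<close> for the number \<open>x\<close>
  representing \<open>\<phi> b\<close>. Injectivity gives \<open>\<phi> b \<noteq> 1\<close>, so \<open>x \<noteq> 0\<close>, and hence \<open>k = 1\<close>
  (\<open>scaling_group_relation_imp_exponents\<close>). So \<open>p \<circ> \<phi>\<close> and \<open>p\<close> agree on the generators.

  That \<open>\<phi> b \<noteq> 1\<close> forces \<open>x \<noteq> 0\<close> needs the semidirect product description for the group given by the
  presentation. The homomorphism into the semidirect product comes from the universal property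
  (\<open>presented_group_lift\<close>); it is injective (\<open>BS1_embedding\<close>) because every element can be brought
  to the form \<open>a\<^sup>i b\<^sup>m a\<^sup>-\<^sup>j\<close> (\<open>BS1_normal_form\<close>).
\<close>

section \<open>Presented groups and their homomorphisms\<close>

definition pres_gen :: "('g gword \<times> 'g gword) set \<Rightarrow> 'g \<Rightarrow> 'g gword set" where
  "pres_gen R x = pres_rel R `` {[Pos x]}"

lemma presented_group_carrier: "carrier (presented_group R) = range (\<lambda>w. pres_rel R `` {w})"
  by (auto simp: presented_group_def quotient_def)

lemma presented_group_one: "\<one>\<^bsub>presented_group R\<^esub> = pres_rel R `` {[]}"
  by (simp add: presented_group_def)

lemma pres_gen_closed [simp]: "pres_gen R x \<in> carrier (presented_group R)"
  by (auto simp: pres_gen_def presented_group_carrier)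

lemma inv_pres_gen: "inv\<^bsub>presented_group R\<^esub> (pres_gen R x) = pres_rel R `` {[Neg x]}"
proof (rule group.inv_equality[OF group_presented_group])
  have "([Neg x, Pos x], []) \<in> pres_rel R"
    using pres_rel.cancel[of "Neg x" R] by simp
  then show "pres_rel R `` {[Neg x]} \<otimes>\<^bsub>presented_group R\<^esub> pres_gen R x = \<one>\<^bsub>presented_group R\<^esub>"
    by (simp add: pres_gen_def presented_group_mult presented_group_one
        equiv_class_eq[OF equiv_pres_rel])
qed (auto simp: presented_group_carrier pres_gen_def)

lemma presented_group_induct [consumes 1, case_names one gen inv_gen]:
  assumes "X \<in> carrier (presented_group R)"
    and one: "P \<one>\<^bsub>presented_group R\<^esub>"
    and gen: "\<And>x Y. Y \<in> carrier (presented_group R) \<Longrightarrow> P Y \<Longrightarrow>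
      P (pres_gen R x \<otimes>\<^bsub>presented_group R\<^esub> Y)"
    and inv_gen: "\<And>x Y. Y \<in> carrier (presented_group R) \<Longrightarrow> P Y \<Longrightarrow>
      P (inv\<^bsub>presented_group R\<^esub> (pres_gen R x) \<otimes>\<^bsub>presented_group R\<^esub> Y)"
  shows "P X"
proof -
  have "P (pres_rel R `` {w})" for w
  proof (induction w)
    case Nil
    show ?case using one by (simp add: presented_group_one)
  next
    case (Cons l w)
    have "pres_rel R `` {w} \<in> carrier (presented_group R)"
      by (auto simp: presented_group_carrier)
    from gen[OF this Cons.IH] inv_gen[OF this Cons.IH] show ?case
      unfolding inv_pres_gen by (cases l) (simp_all add: pres_gen_def presented_group_mult)
  qed
  then show ?thesis using assms(1) by (auto simp: presented_group_carrier)
qed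

lemma presented_group_hom_eqI:
  assumes "group H" and g: "g \<in> hom (presented_group R) H" and h: "h \<in> hom (presented_group R) H"
    and gen: "\<And>x. g (pres_gen R x) = h (pres_gen R x)"
    and "X \<in> carrier (presented_group R)"
  shows "g X = h X"
proof -
  interpret G: group "presented_group R" by (rule group_presented_group)
  interpret g: group_hom "presented_group R" H g
    using assms by (simp add: group_hom_def group_hom_axioms_def group_presented_group)
  interpret h: group_hom "presented_group R" H h
    using assms by (simp add: group_hom_def group_hom_axioms_def group_presented_group)
  from \<open>X \<in> carrier (presented_group R)\<close> show ?thesis
    by (induction rule: presented_group_induct) (simp_all add: gen)
qed

primrec letter_eval :: "('h, 'm) monoid_scheme \<Rightarrow> ('g \<Rightarrow> 'h) \<Rightarrow> 'g letter \<Rightarrow> 'h" where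
  "letter_eval H f (Pos x) = f x"
| "letter_eval H f (Neg x) = inv\<^bsub>H\<^esub> (f x)"

primrec word_eval :: "('h, 'm) monoid_scheme \<Rightarrow> ('g \<Rightarrow> 'h) \<Rightarrow> 'g gword \<Rightarrow> 'h" where
  "word_eval H f [] = \<one>\<^bsub>H\<^esub>"
| "word_eval H f (l # w) = letter_eval H f l \<otimes>\<^bsub>H\<^esub> word_eval H f w"

context group
begin

lemma letter_eval_closed: "(\<And>x. f x \<in> carrier G) \<Longrightarrow> letter_eval G f l \<in> carrier G"
  by (cases l) auto

lemma word_eval_closed: "(\<And>x. f x \<in> carrier G) \<Longrightarrow> word_eval G f w \<in> carrier G"
  by (induction w) (auto simp: letter_eval_closed)

lemma word_eval_append:
  "(\<And>x. f x \<in> carrier G) \<Longrightarrow> word_eval G f (u @ v) = word_eval G f u \<otimes> word_eval G f v"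
  by (induction u) (auto simp: letter_eval_closed word_eval_closed m_assoc)

lemma word_eval_pres_rel:
  assumes f: "\<And>x. f x \<in> carrier G"
    and R: "\<And>u v. (u, v) \<in> R \<Longrightarrow> word_eval G f u = word_eval G f v"
    and "(u, v) \<in> pres_rel R"
  shows "word_eval G f u = word_eval G f v"
  using assms(3)
proof induction
  case (cancel l)
  then show ?case by (cases l) (auto simp: f)
qed (auto simp: f R word_eval_append)

text \<open>The universal property of a presentation: images of the generators that satisfy the relations
  extend to a homomorphism.\<close>

lemma presented_group_lift:
  assumes f: "\<And>x. f x \<in> carrier G"
    and R: "\<And>u v. (u, v) \<in> R \<Longrightarrow> word_eval G f u = word_eval G f v"
  obtains h where "h \<in> hom (presented_group R) G" "\<And>x. h (pres_gen R x) = f x"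
proof -
  define h where "h X = the_elem (word_eval G f ` X)" for X
  have h: "h (pres_rel R `` {w}) = word_eval G f w" for w
  proof -
    have "word_eval G f ` (pres_rel R `` {w}) = {word_eval G f w}"
    proof
      show "word_eval G f ` (pres_rel R `` {w}) \<subseteq> {word_eval G f w}"
        by (auto intro!: word_eval_pres_rel[OF f R, symmetric])
      show "{word_eval G f w} \<subseteq> word_eval G f ` (pres_rel R `` {w})"
        using pres_rel.refl[of w R] by blast
    qed
    then show ?thesis by (simp add: h_def)
  qed
  show thesis
  proof (rule that)
    show "h \<in> hom (presented_group R) G"
      by (rule homI)
        (auto simp: presented_group_carrier presented_group_mult h word_eval_append word_eval_closed f)
    show "h (pres_gen R x) = f x" for x
      by (simp add: pres_gen_def h f)
  qed
qed

end

section \<open>An invariant of twisted conjugacy\<close>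

text \<open>For \<open>p\<close> with abelian target and \<open>p \<circ> \<phi> = p\<close>, the factors \<open>p g\<close> and \<open>p (\<phi> g\<^sup>-\<^sup>1)\<close> cancel in
  \<open>p (g x \<phi> (g\<^sup>-\<^sup>1))\<close>. Hence \<open>p\<close> descends to the twisted conjugacy classes, and there are at least as
  many of these as values of \<open>p\<close>.\<close>

lemma (in group) reidemeister_number_infinite_if_fixed_hom:
  assumes "comm_group H" and \<phi>: "\<phi> \<in> hom G G" and p: "p \<in> hom G H"
    and fixed: "\<And>x. x \<in> carrier G \<Longrightarrow> p (\<phi> x) = p x"
    and inf: "infinite (p ` carrier G)"
  shows "reidemeister_number G \<phi> = \<infinity>"
proof -
  interpret H: comm_group H by fact
  interpret p: group_hom G H p using p by unfold_locales
  interpret \<phi>: group_hom G G \<phi> using \<phi> by unfold_locales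
  let ?\<C> = "carrier G // twisted_conj G \<phi>"
  have p_eq: "p x' = p x" if xx': "(x, x') \<in> twisted_conj G \<phi>" for x x'
  proof -
    obtain g where g: "g \<in> carrier G" "x \<in> carrier G" "x' = g \<otimes> x \<otimes> \<phi> (inv g)"
      using xx' by (auto simp: twisted_conj_def)
    then have "p x' = p g \<otimes>\<^bsub>H\<^esub> p x \<otimes>\<^bsub>H\<^esub> inv\<^bsub>H\<^esub> p g"
      using fixed[of "inv g"] by simp
    also have "\<dots> = p x"
      using g by (simp add: H.m_comm[of "p g"] H.m_assoc)
    finally show ?thesis .
  qed
  have p_class: "p ` (twisted_conj G \<phi> `` {x}) = {p x}" if "x \<in> carrier G" for x
  proof
    show "p ` (twisted_conj G \<phi> `` {x}) \<subseteq> {p x}"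
      using p_eq[of x] by blast
    show "{p x} \<subseteq> p ` (twisted_conj G \<phi> `` {x})"
      using equiv_class_self[OF equiv_twisted_conj[OF \<phi>] that] by blast
  qed
  have "p ` carrier G \<subseteq> (\<lambda>C. the_elem (p ` C)) ` ?\<C>"
  proof
    fix y assume "y \<in> p ` carrier G"
    then obtain x where x: "x \<in> carrier G" "y = p x" by auto
    then have "y = the_elem (p ` (twisted_conj G \<phi> `` {x}))" by (simp add: p_class)
    then show "y \<in> (\<lambda>C. the_elem (p ` C)) ` ?\<C>" using x by (auto intro: quotientI)
  qed
  then have "infinite ?\<C>" using inf finite_surj by blast
  then show ?thesis by (simp add: reidemeister_number_def)
qed

section \<open>The semidirect product of the rationals and the integers\<close>

text \<open>The pair \<open>(k, x)\<close> stands for \<open>b\<^sup>x a\<^sup>k\<close>, where \<open>a b\<^sup>x a\<^sup>-\<^sup>1 = b\<^sup>x\<^sup>/\<^sup>q\<close>; this is the action that makes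
  \<open>a\<^sup>-\<^sup>1 b a = b\<^sup>q\<close> hold.\<close>

definition scaling_group :: "rat \<Rightarrow> (int \<times> rat) monoid" where
  "scaling_group q = \<lparr>carrier = UNIV,
     mult = (\<lambda>(k, x) (l, y). (k + l, x + q powi (- k) * y)),
     one = (0, 0)\<rparr>"

lemma scaling_group_simps [simp]:
  "carrier (scaling_group q) = UNIV"
  "(k, x) \<otimes>\<^bsub>scaling_group q\<^esub> (l, y) = (k + l, x + q powi (- k) * y)"
  "\<one>\<^bsub>scaling_group q\<^esub> = (0, 0)"
  by (simp_all add: scaling_group_def)

lemma group_scaling_group:
  assumes "q \<noteq> 0"
  shows "group (scaling_group q)"
proof (rule groupI)
  fix X Y Z :: "int \<times> rat"
  show "X \<otimes>\<^bsub>scaling_group q\<^esub> Y \<otimes>\<^bsub>scaling_group q\<^esub> Z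
      = X \<otimes>\<^bsub>scaling_group q\<^esub> (Y \<otimes>\<^bsub>scaling_group q\<^esub> Z)"
    using assms power_int_add[of q "- fst X" "- fst Y"]
    by (cases X; cases Y; cases Z) (simp add: algebra_simps)
next
  fix X :: "int \<times> rat"
  have "(- fst X, - (q powi fst X * snd X)) \<otimes>\<^bsub>scaling_group q\<^esub> X = \<one>\<^bsub>scaling_group q\<^esub>"
    by (cases X) simp
  then show "\<exists>Y\<in>carrier (scaling_group q). Y \<otimes>\<^bsub>scaling_group q\<^esub> X = \<one>\<^bsub>scaling_group q\<^esub>"
    by (metis UNIV_I scaling_group_simps(1))
next
  fix X :: "int \<times> rat"
  show "\<one>\<^bsub>scaling_group q\<^esub> \<otimes>\<^bsub>scaling_group q\<^esub> X = X"
    by (cases X) simp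
qed simp_all

lemma fst_hom_scaling_group: "fst \<in> hom (scaling_group q) integer_group"
  by (auto intro!: homI)

lemma scaling_group_nat_pow:
  "(0, x) [^]\<^bsub>scaling_group q\<^esub> (m :: nat) = (0, of_nat m * x)"
  "(1, 0) [^]\<^bsub>scaling_group q\<^esub> (m :: nat) = (int m, 0)"
  by (induction m) (simp_all add: algebra_simps)

lemma scaling_group_int_pow:
  assumes "q \<noteq> 0"
  shows "(0, x) [^]\<^bsub>scaling_group q\<^esub> (m :: int) = (0, of_int m * x)"
proof -
  interpret group "scaling_group q" by (rule group_scaling_group) fact
  have "inv\<^bsub>scaling_group q\<^esub> (0, y) = (0, - y)" for y
    by (rule inv_equality) simp_all
  then show ?thesis by (simp add: int_pow_def2 scaling_group_nat_pow)
qed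

text \<open>Here \<open>X\<close> and \<open>Y\<close> stand for the images of \<open>b\<close> and \<open>a\<close> under some homomorphism, and \<open>rel\<close> is the
  relation \<open>ba = ab\<^sup>n\<close>. Its first component forces \<open>X = (0, x)\<close>. With \<open>Y = (k, y)\<close>, the second
  component is then \<open>x = q\<^sup>1\<^sup>-\<^sup>k x\<close> with \<open>x \<noteq> 0\<close> and \<open>q > 1\<close>.\<close>

lemma scaling_group_relation_imp_exponents:
  assumes n: "n > 1" and q: "q = of_nat n"
    and rel: "X \<otimes>\<^bsub>scaling_group q\<^esub> Y = Y \<otimes>\<^bsub>scaling_group q\<^esub> X [^]\<^bsub>scaling_group q\<^esub> n"
    and X: "X \<noteq> \<one>\<^bsub>scaling_group q\<^esub>"
  shows "fst X = 0" "fst Y = 1"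
proof -
  obtain s x where sx: "X = (s, x)" by (cases X)
  obtain k y where ky: "Y = (k, y)" by (cases Y)
  have q1: "q > 1" using n q by simp
  interpret p: group_hom "scaling_group q" integer_group fst
    using q1 fst_hom_scaling_group[of q]
    by (simp add: group_hom_def group_hom_axioms_def group_scaling_group)
  have "fst X + fst Y = fst Y + int n * fst X"
    using arg_cong[OF rel, of fst] p.hom_nat_pow[of X n] by (simp add: p.hom_mult)
  then have "(int n - 1) * fst X = 0" by (simp add: algebra_simps)
  then show 0: "fst X = 0" using n by simp
  then have "x \<noteq> 0" using X sx by simp
  have "x = q powi (- k) * (q * x)"
    using rel 0 by (simp add: sx ky scaling_group_nat_pow q)
  then have "q powi (- k) * q = 1" using \<open>x \<noteq> 0\<close> by simp
  then have "q powi (1 - k) = 1" using q1 power_int_add_1[of q "- k"] by simp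
  moreover have "q powi (1 - k) > 1" if "k < 1"
    using power_int_strict_increasing[of 0 "1 - k" q] that q1 by simp
  moreover have "q powi (1 - k) < 1" if "k > 1"
    using power_int_strict_increasing[of "1 - k" 0 q] that q1 by simp
  ultimately show "fst Y = 1" using ky by (cases k "1 :: int" rule: linorder_cases) auto
qed

section \<open>The Baumslag--Solitar group as a semidirect product\<close>

definition bs_rels :: "nat \<Rightarrow> (bs_gen gword \<times> bs_gen gword) set" where
  "bs_rels n = {([Neg gen_a, Pos gen_b, Pos gen_a], replicate n (Pos gen_b))}"

abbreviation bs_a :: "nat \<Rightarrow> bs_gen gword set" where "bs_a n \<equiv> pres_gen (bs_rels n) gen_a"
abbreviation bs_b :: "nat \<Rightarrow> bs_gen gword set" where "bs_b n \<equiv> pres_gen (bs_rels n) gen_b"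

lemma BS1_eq: "BS1 n = presented_group (bs_rels n)"
  by (simp add: BS1_def bs_rels_def)

lemma group_BS1: "group (BS1 n)"
  by (simp add: BS1_eq group_presented_group)

lemma BS1_gen_closed [simp]: "pres_gen (bs_rels n) x \<in> carrier (BS1 n)"
  by (simp add: BS1_eq)

lemma BS1_relation: "bs_b n \<otimes>\<^bsub>BS1 n\<^esub> bs_a n = bs_a n \<otimes>\<^bsub>BS1 n\<^esub> bs_b n [^]\<^bsub>BS1 n\<^esub> n"
proof -
  interpret group "BS1 n" by (rule group_BS1)
  have pow: "bs_b n [^]\<^bsub>BS1 n\<^esub> m = pres_rel (bs_rels n) `` {replicate m (Pos gen_b)}" for m :: nat
  proof (induction m)
    case 0
    show ?case by (simp add: BS1_eq presented_group_one)
  next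
    case (Suc m)
    then show ?case
      by (simp add: BS1_eq pres_gen_def presented_group_mult replicate_append_same)
  qed
  have "inv\<^bsub>BS1 n\<^esub> bs_a n \<otimes>\<^bsub>BS1 n\<^esub> bs_b n \<otimes>\<^bsub>BS1 n\<^esub> bs_a n
      = pres_rel (bs_rels n) `` {[Neg gen_a, Pos gen_b, Pos gen_a]}"
    by (simp add: BS1_eq inv_pres_gen) (simp add: pres_gen_def presented_group_mult)
  also have "\<dots> = bs_b n [^]\<^bsub>BS1 n\<^esub> n"
    unfolding pow by (rule equiv_class_eq[OF equiv_pres_rel], rule pres_rel.rel)
      (simp add: bs_rels_def)
  finally have "bs_b n [^]\<^bsub>BS1 n\<^esub> n = inv\<^bsub>BS1 n\<^esub> bs_a n \<otimes>\<^bsub>BS1 n\<^esub> (bs_b n \<otimes>\<^bsub>BS1 n\<^esub> bs_a n)"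
    by (simp add: m_assoc)
  then show ?thesis by (simp add: inv_solve_left)
qed

text \<open>The relation moves every nonnegative power of \<open>a\<close> to the left past every power of \<open>b\<close>.\<close>

lemma (in group) int_pow_nat_pow_swap:
  assumes [simp]: "a \<in> carrier G" "b \<in> carrier G" and rel: "b \<otimes> a = a \<otimes> b [^] (n :: nat)"
  shows "b [^] (m :: int) \<otimes> a [^] (i :: nat) = a [^] i \<otimes> b [^] (m * int n ^ i)"
proof (induction i arbitrary: m)
  case 0
  show ?case by simp
next
  case (Suc i)
  \<comment> \<open>Conjugation by \<open>a\<close> is a homomorphism taking \<open>b\<^sup>n\<close> to \<open>b\<close>, so it takes \<open>b\<^sup>n\<^sup>k\<close> to \<open>b\<^sup>k\<close>,
    also for negative \<open>k\<close>.\<close>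
  have conj: "b = a \<otimes> b [^] n \<otimes> inv a"
    by (simp flip: rel add: m_assoc)
  have cancel: "inv a \<otimes> (a \<otimes> x) = x" if "x \<in> carrier G" for x
    using that by (simp flip: m_assoc)
  have "b [^] k \<otimes> a = a \<otimes> b [^] (k * int n)" for k :: int
  proof -
    have "(b [^] n) [^] k = b [^] (k * int n)"
      by (simp add: int_pow_pow mult.commute flip: int_pow_int)
    moreover have "b [^] k = a \<otimes> (b [^] n) [^] k \<otimes> inv a"
    proof -
      have "(\<lambda>x. a \<otimes> x \<otimes> inv a) \<in> hom G G"
        by (rule homI) (simp_all add: m_assoc cancel)
      from hom_int_pow[OF this _ group_axioms group_axioms, of "b [^] n" k]
      show ?thesis by (simp flip: conj)
    qed
    ultimately show ?thesis by (simp add: m_assoc)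
  qed
  then show ?case
    using Suc.IH[of m] by (simp add: m_assoc[symmetric]) (simp add: m_assoc mult_ac)
qed

text \<open>This is the form \<open>X = a\<^sup>i b\<^sup>m a\<^sup>-\<^sup>j\<close>. Multiplying by a power of \<open>a\<close> on the right keeps all
  exponents of \<open>a\<close> nonnegative, where the relation applies without inverses: multiplication of \<open>X\<close> by
  \<open>a\<^sup>-\<^sup>1\<close> on the left is absorbed by one more factor \<open>a\<close> on the right.\<close>

lemma BS1_normal_form:
  assumes "X \<in> carrier (BS1 n)"
  obtains i j :: nat and m :: int where
    "X \<otimes>\<^bsub>BS1 n\<^esub> bs_a n [^]\<^bsub>BS1 n\<^esub> j = bs_a n [^]\<^bsub>BS1 n\<^esub> i \<otimes>\<^bsub>BS1 n\<^esub> bs_b n [^]\<^bsub>BS1 n\<^esub> m"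
proof -
  interpret group "BS1 n" by (rule group_BS1)
  define a where "a = bs_a n"
  define b where "b = bs_b n"
  have [simp]: "a \<in> carrier (BS1 n)" "b \<in> carrier (BS1 n)" by (simp_all add: a_def b_def)
  note swap = int_pow_nat_pow_swap[of a b n, OF _ _ BS1_relation[of n, folded a_def b_def], simplified]
  have left_b: "b [^]\<^bsub>BS1 n\<^esub> e \<otimes>\<^bsub>BS1 n\<^esub> Y \<otimes>\<^bsub>BS1 n\<^esub> a [^]\<^bsub>BS1 n\<^esub> j
      = a [^]\<^bsub>BS1 n\<^esub> i \<otimes>\<^bsub>BS1 n\<^esub> b [^]\<^bsub>BS1 n\<^esub> (e * int n ^ i + m)"
    if "Y \<in> carrier (BS1 n)"
      "Y \<otimes>\<^bsub>BS1 n\<^esub> a [^]\<^bsub>BS1 n\<^esub> j = a [^]\<^bsub>BS1 n\<^esub> i \<otimes>\<^bsub>BS1 n\<^esub> b [^]\<^bsub>BS1 n\<^esub> m"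
    for Y and i j :: nat and m e :: int
    using that by (simp add: m_assoc int_pow_mult) (simp add: swap flip: m_assoc)
  have "\<exists>(i :: nat) (j :: nat) (m :: int).
      X \<otimes>\<^bsub>BS1 n\<^esub> a [^]\<^bsub>BS1 n\<^esub> j = a [^]\<^bsub>BS1 n\<^esub> i \<otimes>\<^bsub>BS1 n\<^esub> b [^]\<^bsub>BS1 n\<^esub> m"
    using assms unfolding BS1_eq
  proof (induction rule: presented_group_induct)
    case one
    show ?case
      by (intro exI[of _ 0]) (simp flip: BS1_eq)
  next
    case (gen x Y)
    note gen = gen[folded BS1_eq]
    then obtain i j :: nat and m :: int where
      Y: "Y \<otimes>\<^bsub>BS1 n\<^esub> a [^]\<^bsub>BS1 n\<^esub> j = a [^]\<^bsub>BS1 n\<^esub> i \<otimes>\<^bsub>BS1 n\<^esub> b [^]\<^bsub>BS1 n\<^esub> m"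
      by blast
    show ?case
    proof (cases x)
      case gen_a
      have "a \<otimes>\<^bsub>BS1 n\<^esub> Y \<otimes>\<^bsub>BS1 n\<^esub> a [^]\<^bsub>BS1 n\<^esub> j
          = a [^]\<^bsub>BS1 n\<^esub> Suc i \<otimes>\<^bsub>BS1 n\<^esub> b [^]\<^bsub>BS1 n\<^esub> m"
        using gen Y by (simp only: nat_pow_Suc2 \<open>a \<in> _\<close>) (simp add: m_assoc)
      then show ?thesis unfolding gen_a a_def[symmetric] BS1_eq[symmetric] by blast
    next
      case gen_b
      from left_b[OF gen(1) Y, of 1] show ?thesis
        unfolding gen_b b_def[symmetric] BS1_eq[symmetric] by (auto simp del: nat_pow_Suc)
    qed
  next
    case (inv_gen x Y)
    note inv_gen = inv_gen[folded BS1_eq]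
    then obtain i j :: nat and m :: int where
      Y: "Y \<otimes>\<^bsub>BS1 n\<^esub> a [^]\<^bsub>BS1 n\<^esub> j = a [^]\<^bsub>BS1 n\<^esub> i \<otimes>\<^bsub>BS1 n\<^esub> b [^]\<^bsub>BS1 n\<^esub> m"
      by blast
    show ?case
    proof (cases x)
      case gen_a
      have "inv\<^bsub>BS1 n\<^esub> a \<otimes>\<^bsub>BS1 n\<^esub> Y \<otimes>\<^bsub>BS1 n\<^esub> a [^]\<^bsub>BS1 n\<^esub> Suc j
          = inv\<^bsub>BS1 n\<^esub> a \<otimes>\<^bsub>BS1 n\<^esub> (Y \<otimes>\<^bsub>BS1 n\<^esub> a [^]\<^bsub>BS1 n\<^esub> j) \<otimes>\<^bsub>BS1 n\<^esub> a"
        using inv_gen by (simp add: m_assoc)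
      also have "\<dots> = inv\<^bsub>BS1 n\<^esub> a \<otimes>\<^bsub>BS1 n\<^esub> (a [^]\<^bsub>BS1 n\<^esub> i \<otimes>\<^bsub>BS1 n\<^esub> (b [^]\<^bsub>BS1 n\<^esub> m \<otimes>\<^bsub>BS1 n\<^esub> a))"
        by (simp add: Y m_assoc)
      also have "b [^]\<^bsub>BS1 n\<^esub> m \<otimes>\<^bsub>BS1 n\<^esub> a = a \<otimes>\<^bsub>BS1 n\<^esub> b [^]\<^bsub>BS1 n\<^esub> (m * int n)"
        using swap[of m 1] by simp
      also have "inv\<^bsub>BS1 n\<^esub> a \<otimes>\<^bsub>BS1 n\<^esub>
            (a [^]\<^bsub>BS1 n\<^esub> i \<otimes>\<^bsub>BS1 n\<^esub> (a \<otimes>\<^bsub>BS1 n\<^esub> b [^]\<^bsub>BS1 n\<^esub> (m * int n)))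
          = inv\<^bsub>BS1 n\<^esub> a \<otimes>\<^bsub>BS1 n\<^esub> a [^]\<^bsub>BS1 n\<^esub> Suc i \<otimes>\<^bsub>BS1 n\<^esub> b [^]\<^bsub>BS1 n\<^esub> (m * int n)"
        by (simp add: m_assoc)
      also have "\<dots> = a [^]\<^bsub>BS1 n\<^esub> i \<otimes>\<^bsub>BS1 n\<^esub> b [^]\<^bsub>BS1 n\<^esub> (m * int n)"
        by (simp only: nat_pow_Suc2 \<open>a \<in> _\<close>) (simp flip: m_assoc)
      finally show ?thesis unfolding gen_a a_def[symmetric] BS1_eq[symmetric] by blast
    next
      case gen_b
      from left_b[OF inv_gen(1) Y, of "-1"] show ?thesis
        unfolding gen_b b_def[symmetric] BS1_eq[symmetric]
        by (auto simp: int_pow_neg simp del: nat_pow_Suc)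
    qed
  qed
  then show thesis using that unfolding a_def b_def by blast
qed

text \<open>For injectivity, an element \<open>a\<^sup>i b\<^sup>m a\<^sup>-\<^sup>j\<close> maps to the pair \<open>(i - j, m / n\<^sup>i)\<close>, which is trivial
  only for \<open>i = j\<close> and \<open>m = 0\<close>.\<close>

lemma BS1_embedding:
  assumes n: "n > 0"
  obtains h where "h \<in> hom (BS1 n) (scaling_group (of_nat n))" "inj_on h (carrier (BS1 n))"
    "h (bs_a n) = (1, 0)" "h (bs_b n) = (0, 1)"
proof -
  let ?S = "scaling_group (of_nat n)"
  define f :: "bs_gen \<Rightarrow> int \<times> rat" where "f = case_bs_gen (1, 0) (0, 1)"
  have f: "f gen_a = (1, 0)" "f gen_b = (0, 1)" by (simp_all add: f_def)
  interpret S: group ?S using n by (intro group_scaling_group) simp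
  interpret B: group "BS1 n" by (rule group_BS1)
  have inv_a: "inv\<^bsub>?S\<^esub> (1, 0) = (- 1, 0)" by (rule S.inv_equality) simp_all
  have pow: "word_eval ?S f (replicate m (Pos gen_b)) = (0, of_nat m)" for m
    by (induction m) (simp_all add: f)
  have rels: "word_eval ?S f u = word_eval ?S f v" if "(u, v) \<in> bs_rels n" for u v
    using that by (simp add: bs_rels_def pow f inv_a)
  have f_closed: "f x \<in> carrier ?S" for x
    by simp
  obtain h where h: "h \<in> hom (BS1 n) ?S" "\<And>x. h (pres_gen (bs_rels n) x) = f x"
    unfolding BS1_eq using S.presented_group_lift[OF f_closed rels] by metis
  interpret h: group_hom "BS1 n" ?S h using h(1) by unfold_locales
  have ker: "X = \<one>\<^bsub>BS1 n\<^esub>" if X: "X \<in> carrier (BS1 n)" and "h X = \<one>\<^bsub>?S\<^esub>" for X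
  proof -
    obtain i j :: nat and m :: int where
      ijm: "X \<otimes>\<^bsub>BS1 n\<^esub> bs_a n [^]\<^bsub>BS1 n\<^esub> j
        = bs_a n [^]\<^bsub>BS1 n\<^esub> i \<otimes>\<^bsub>BS1 n\<^esub> bs_b n [^]\<^bsub>BS1 n\<^esub> m"
      by (rule BS1_normal_form[OF X])
    have "h (X \<otimes>\<^bsub>BS1 n\<^esub> bs_a n [^]\<^bsub>BS1 n\<^esub> j) = (int j, 0)"
      using X \<open>h X = \<one>\<^bsub>?S\<^esub>\<close> by (simp add: h.hom_nat_pow h(2) f scaling_group_nat_pow)
    moreover have "h (bs_a n [^]\<^bsub>BS1 n\<^esub> i \<otimes>\<^bsub>BS1 n\<^esub> bs_b n [^]\<^bsub>BS1 n\<^esub> m)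
        = (int i, of_nat n powi (- int i) * of_int m)"
      using n by (simp add: h.hom_nat_pow h.hom_int_pow h(2) f scaling_group_nat_pow
          scaling_group_int_pow)
    ultimately have "i = j" "m = 0" using ijm n by auto
    then have "X \<otimes>\<^bsub>BS1 n\<^esub> bs_a n [^]\<^bsub>BS1 n\<^esub> j = bs_a n [^]\<^bsub>BS1 n\<^esub> j"
      using ijm by simp
    then show ?thesis using X by simp
  qed
  have "inj_on h (carrier (BS1 n))"
    using ker by (auto simp: h.inj_iff_trivial_ker kernel_def)
  then show thesis
    using that[OF h(1)] by (simp add: h(2) f)
qed

section \<open>Injective endomorphisms\<close>

theorem theorem12p5:
  fixes n :: nat and \<phi> :: "bs_gen gword set \<Rightarrow> bs_gen gword set"
  assumes "n > 1"
    and "\<phi> \<in> hom (BS1 n) (BS1 n)"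
    and "inj_on \<phi> (carrier (BS1 n))"
  shows "reidemeister_number (BS1 n) \<phi> = \<infinity>"
proof -
  let ?S = "scaling_group (of_nat n)"
  obtain h where h: "h \<in> hom (BS1 n) ?S" and inj_h: "inj_on h (carrier (BS1 n))"
    and h_a: "h (bs_a n) = (1, 0)" and h_b: "h (bs_b n) = (0, 1)"
    by (rule BS1_embedding[of n]) (use \<open>n > 1\<close> in auto)
  interpret B: group "BS1 n" by (rule group_BS1)
  interpret S: group ?S using \<open>n > 1\<close> by (intro group_scaling_group) simp
  have h\<phi>: "h \<circ> \<phi> \<in> hom (BS1 n) ?S"
    using assms(2) h by (rule Group.hom_compose)
  interpret h\<phi>: group_hom "BS1 n" ?S "h \<circ> \<phi>" using h\<phi> by unfold_locales
  interpret h: group_hom "BS1 n" ?S h using h by unfold_locales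
  have "inj_on (h \<circ> \<phi>) (carrier (BS1 n))"
    using assms(2,3) inj_h by (intro comp_inj_on inj_on_subset[OF inj_h]) (auto simp: hom_def)
  moreover have "bs_b n \<noteq> \<one>\<^bsub>BS1 n\<^esub>" using h_b h.hom_one by auto
  ultimately have nontriv: "(h \<circ> \<phi>) (bs_b n) \<noteq> \<one>\<^bsub>?S\<^esub>"
    using h\<phi>.hom_one by (metis B.one_closed BS1_gen_closed inj_onD)
  have rel: "(h \<circ> \<phi>) (bs_b n) \<otimes>\<^bsub>?S\<^esub> (h \<circ> \<phi>) (bs_a n)
      = (h \<circ> \<phi>) (bs_a n) \<otimes>\<^bsub>?S\<^esub> (h \<circ> \<phi>) (bs_b n) [^]\<^bsub>?S\<^esub> n"
    using arg_cong[OF BS1_relation[of n], of "h \<circ> \<phi>"]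
    by (simp add: h\<phi>.hom_mult h\<phi>.hom_nat_pow del: comp_apply)
  note exponents = scaling_group_relation_imp_exponents[OF \<open>n > 1\<close> HOL.refl rel nontriv]
  have p: "fst \<circ> h \<in> hom (BS1 n) integer_group"
    using h fst_hom_scaling_group by (rule Group.hom_compose)
  have p\<phi>: "(fst \<circ> h) \<circ> \<phi> \<in> hom (BS1 n) integer_group"
    using assms(2) p by (rule Group.hom_compose)
  have gens: "((fst \<circ> h) \<circ> \<phi>) (pres_gen (bs_rels n) x) = (fst \<circ> h) (pres_gen (bs_rels n) x)" for x
    using exponents by (cases x) (simp_all add: h_a h_b)
  show ?thesis
  proof (rule B.reidemeister_number_infinite_if_fixed_hom[OF abelian_integer_group assms(2) p])
    show "(fst \<circ> h) (\<phi> X) = (fst \<circ> h) X" if "X \<in> carrier (BS1 n)" for X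
      using presented_group_hom_eqI[OF group_integer_group p\<phi>[unfolded BS1_eq] p[unfolded BS1_eq] gens]
        that by (simp add: BS1_eq)
    have "int m \<in> (fst \<circ> h) ` carrier (BS1 n)" for m :: nat
      by (rule image_eqI[of _ _ "bs_a n [^]\<^bsub>BS1 n\<^esub> m"])
        (simp_all add: h.hom_nat_pow h_a scaling_group_nat_pow)
    then have "range int \<subseteq> (fst \<circ> h) ` carrier (BS1 n)" by (rule image_subsetI)
    then show "infinite ((fst \<circ> h) ` carrier (BS1 n))"
      using range_inj_infinite[of int] infinite_super by auto
  qed
qed

end
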